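(* Let $n\ge 1$ and let $\mathcal{N}=A^+(B_n)\cup\{0\}$ be the zero-symmetric affine near-semiring over the Brandt semigroup $B_n$. Then $\mathcal{N}$ and $\{0\}$ are the only right ideals of $\mathcal{N}$.
   Context: Arguments of maps are written on the left: $xf$ is the value of $f$ at $x$. A near-semiring is a triple $(\mathcal{M},+,\cdot)$ such that $(\mathcal{M},+)$ and $(\mathcal{M},\cdot)$ are semigroups (not assumed commutative) and $a\cdot(b+c)=a\cdot b+a\cdot c$ for all $a,b,c$. It is zero-symmetric if there is $0\in\mathcal{M}$ with $a+0=0+a=a$ and $a\cdot 0=0\cdot a=0$ for all $a$. For a semigroup $(S,+)$, $M(S)$ is the near-semiring of all maps $S\to S$ with $x(f+g)=xf+xg$ and $x(fg)=(xf)g$. An affine map on $S$ is a map $g+h$ with $g$ an endomorphism of $(S,+)$ and $h$ a constant map on $S$. $A^+(S)$ is the subnear-semiring of $M(S)$ generated by all affine maps. The Brandt semigroup is $B_n=([n]\times[n])\cup\{\vartheta\}$, $[n]=\{1,\dots,n\}$, with $(i,j)+(k,l)=(i,l)$ if $j=k$ and $=\vartheta$ if $j\ne k$, and $\alpha+\vartheta=\vartheta+\alpha=\vartheta$ for all $\alpha\in B_n$. $\mathcal{N}=A^+(B_n)\cup\{0\}$, where $0$ is a new element adjoined to $A^+(B_n)$ with $0+f=f+0=f$ and $0f=f0=0$ for all $f\in\mathcal{N}$; it is a zero-symmetric near-semiring. An $\mathcal{N}$-semigroup is a semigroup $(S,+)$ with identity $0_S$ and a map $S\times\mathcal{N}\to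 S$, $(s,a)\mapsto sa$, such that $s(a+b)=sa+sb$, $s(ab)=(sa)b$ and $s0=0_S$ for all $s\in S$, $a,b\in\mathcal{N}$. $\mathcal{N}^+$ denotes $(\mathcal{N},+)$ regarded as an $\mathcal{N}$-semigroup via the multiplication of $\mathcal{N}$. An $\mathcal{N}$-morphism between $\mathcal{N}$-semigroups $S,S'$ is a semigroup homomorphism $\phi:S\to S'$ with $(sa)\phi=(s\phi)a$ for all $s\in S,a\in\mathcal{N}$; its kernel is $\{s\in S: s\phi=0_{S'}\}$. A right ideal of $\mathcal{N}$ is the kernel of an $\mathcal{N}$-morphism from $\mathcal{N}^+$ to some $\mathcal{N}$-semigroup. *)

theory Defs
  imports "HOL-Algebra.Congruence" "HOL-Library.FuncSet"
begin

section \<open>Semigroups and near-semirings with explicit carriers\<close>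

text \<open>The semigroup classes of HOL live on whole types and the structures of HOL-Algebra all have an
  identity, so the (possibly identity-free, non-commutative) additive structures are records here.\<close>

record 'a add_sgrp = "'a partial_object" +
  splus :: "'a \<Rightarrow> 'a \<Rightarrow> 'a" (infixl "\<oplus>\<index>" 65)

record 'a nsring = "'a add_sgrp" +
  stimes :: "'a \<Rightarrow> 'a \<Rightarrow> 'a" (infixl "\<otimes>\<index>" 70)

record 'a nsring0 = "'a nsring" +
  szero :: 'a ("\<zero>\<index>")

definition semigroup_on :: "'a set \<Rightarrow> ('a \<Rightarrow> 'a \<Rightarrow> 'a) \<Rightarrow> bool" where
  "semigroup_on A f \<longleftrightarrow>
     (\<forall>x\<in>A. \<forall>y\<in>A. f x y \<in> A) \<and>
     (\<forall>x\<in>A. \<forall>y\<in>A. \<forall>z\<in>A. f (f x y) z = f x (f y z))"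

definition near_semiring :: "('a, 'm) nsring_scheme \<Rightarrow> bool" where
  "near_semiring R \<longleftrightarrow>
     semigroup_on (carrier R) (splus R) \<and> semigroup_on (carrier R) (stimes R) \<and>
     (\<forall>a\<in>carrier R. \<forall>b\<in>carrier R. \<forall>c\<in>carrier R.
        a \<otimes>\<^bsub>R\<^esub> (b \<oplus>\<^bsub>R\<^esub> c) = a \<otimes>\<^bsub>R\<^esub> b \<oplus>\<^bsub>R\<^esub> a \<otimes>\<^bsub>R\<^esub> c)"

definition zero_symmetric_near_semiring :: "('a, 'm) nsring0_scheme \<Rightarrow> bool" where
  "zero_symmetric_near_semiring R \<longleftrightarrow>
     near_semiring R \<and> \<zero>\<^bsub>R\<^esub> \<in> carrier R \<and>
     (\<forall>a\<in>carrier R. a \<oplus>\<^bsub>R\<^esub> \<zero>\<^bsub>R\<^esub> = a \<and> \<zero>\<^bsub>R\<^esub> \<oplus>\<^bsub>R\<^esub> a = a \<and>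
                    a \<otimes>\<^bsub>R\<^esub> \<zero>\<^bsub>R\<^esub> = \<zero>\<^bsub>R\<^esub> \<and> \<zero>\<^bsub>R\<^esub> \<otimes>\<^bsub>R\<^esub> a = \<zero>\<^bsub>R\<^esub>)"


section \<open>Maps on a semigroup and the affine near-semiring\<close>

text \<open>Maps \<open>S \<rightarrow> S\<close> are functions extensional on \<open>carrier S\<close>, so that equality of maps is equality
  of functions.  Arguments are written on the left in the mathematics, \<open>x (f g) = (x f) g\<close>:
  a product applies its left factor first.\<close>

definition map_nsring :: "('a, 'm) add_sgrp_scheme \<Rightarrow> ('a \<Rightarrow> 'a) nsring" where
  "map_nsring S = \<lparr>carrier = carrier S \<rightarrow>\<^sub>E carrier S,
     splus = (\<lambda>f g. \<lambda>x\<in>carrier S. f x \<oplus>\<^bsub>S\<^esub> g x),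
     stimes = (\<lambda>f g. \<lambda>x\<in>carrier S. g (f x))\<rparr>"

definition sgrp_End :: "('a, 'm) add_sgrp_scheme \<Rightarrow> ('a \<Rightarrow> 'a) set" where
  "sgrp_End S = {g \<in> carrier S \<rightarrow>\<^sub>E carrier S.
     \<forall>x\<in>carrier S. \<forall>y\<in>carrier S. g (x \<oplus>\<^bsub>S\<^esub> y) = g x \<oplus>\<^bsub>S\<^esub> g y}"

definition const_maps :: "('a, 'm) add_sgrp_scheme \<Rightarrow> ('a \<Rightarrow> 'a) set" where
  "const_maps S = {\<lambda>x\<in>carrier S. c | c. c \<in> carrier S}"

definition affine_maps :: "('a, 'm) add_sgrp_scheme \<Rightarrow> ('a \<Rightarrow> 'a) set" where
  "affine_maps S = {g \<oplus>\<^bsub>map_nsring S\<^esub> h | g h. g \<in> sgrp_End S \<and> h \<in> const_maps S}"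

inductive_set subnsring_gen :: "('a, 'm) nsring_scheme \<Rightarrow> 'a set \<Rightarrow> 'a set"
  for R :: "('a, 'm) nsring_scheme" and X :: "'a set" where
  gen: "a \<in> X \<Longrightarrow> a \<in> subnsring_gen R X"
| add: "a \<in> subnsring_gen R X \<Longrightarrow> b \<in> subnsring_gen R X \<Longrightarrow> a \<oplus>\<^bsub>R\<^esub> b \<in> subnsring_gen R X"
| mult: "a \<in> subnsring_gen R X \<Longrightarrow> b \<in> subnsring_gen R X \<Longrightarrow> a \<otimes>\<^bsub>R\<^esub> b \<in> subnsring_gen R X"

definition affine_nsring :: "('a, 'm) add_sgrp_scheme \<Rightarrow> ('a \<Rightarrow> 'a) nsring" where
  "affine_nsring S =
     (map_nsring S)\<lparr>carrier := subnsring_gen (map_nsring S) (affine_maps S)\<rparr>"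

text \<open>The adjoined element \<open>None\<close> is new even if the near-semiring already has a zero.\<close>

definition adjoin_zero :: "'a nsring \<Rightarrow> 'a option nsring0" where
  "adjoin_zero R = \<lparr>carrier = insert None (Some ` carrier R),
     splus = (\<lambda>a b. case (a, b) of
                (None, _) \<Rightarrow> b | (_, None) \<Rightarrow> a | (Some f, Some g) \<Rightarrow> Some (f \<oplus>\<^bsub>R\<^esub> g)),
     stimes = (\<lambda>a b. case (a, b) of
                (Some f, Some g) \<Rightarrow> Some (f \<otimes>\<^bsub>R\<^esub> g) | _ \<Rightarrow> None),
     szero = None\<rparr>"


section \<open>The Brandt semigroup\<close>

datatype brandt = Pt nat nat | Theta

fun brandt_add :: "brandt \<Rightarrow> brandt \<Rightarrow> brandt" where
  "brandt_add (Pt i j) (Pt k l) = (if j = k then Pt i l else Theta)"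
| "brandt_add Theta _ = Theta"
| "brandt_add _ Theta = Theta"

definition Brandt :: "nat \<Rightarrow> brandt add_sgrp" where
  "Brandt n = \<lparr>carrier = insert Theta {Pt i j | i j. i \<in> {1..n} \<and> j \<in> {1..n}},
     splus = brandt_add\<rparr>"

definition Brandt_affine :: "nat \<Rightarrow> (brandt \<Rightarrow> brandt) option nsring0" where
  "Brandt_affine n = adjoin_zero (affine_nsring (Brandt n))"


section \<open>Semigroups over a near-semiring and right ideals\<close>

record ('s, 'a) nsgrp = "'s add_sgrp" +
  sident :: 's
  act :: "'s \<Rightarrow> 'a \<Rightarrow> 's" (infixl "\<odot>\<index>" 70)

definition near_semiring_semigroup ::
    "('a, 'm) nsring0_scheme \<Rightarrow> ('s, 'a, 'k) nsgrp_scheme \<Rightarrow> bool" where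
  "near_semiring_semigroup R S \<longleftrightarrow>
     semigroup_on (carrier S) (splus S) \<and>
     sident S \<in> carrier S \<and>
     (\<forall>s\<in>carrier S. sident S \<oplus>\<^bsub>S\<^esub> s = s \<and> s \<oplus>\<^bsub>S\<^esub> sident S = s) \<and>
     (\<forall>s\<in>carrier S. \<forall>a\<in>carrier R. s \<odot>\<^bsub>S\<^esub> a \<in> carrier S) \<and>
     (\<forall>s\<in>carrier S. \<forall>a\<in>carrier R. \<forall>b\<in>carrier R.
        s \<odot>\<^bsub>S\<^esub> (a \<oplus>\<^bsub>R\<^esub> b) = s \<odot>\<^bsub>S\<^esub> a \<oplus>\<^bsub>S\<^esub> s \<odot>\<^bsub>S\<^esub> b \<and>
        s \<odot>\<^bsub>S\<^esub> (a \<otimes>\<^bsub>R\<^esub> b) = s \<odot>\<^bsub>S\<^esub> a \<odot>\<^bsub>S\<^esub> b) \<and>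
     (\<forall>s\<in>carrier S. s \<odot>\<^bsub>S\<^esub> \<zero>\<^bsub>R\<^esub> = sident S)"

definition regular_nsgrp :: "('a, 'm) nsring0_scheme \<Rightarrow> ('a, 'a) nsgrp" where
  "regular_nsgrp R = \<lparr>carrier = carrier R, splus = splus R, sident = \<zero>\<^bsub>R\<^esub>, act = stimes R\<rparr>"

definition nsgrp_morphism :: "('a, 'm) nsring0_scheme \<Rightarrow> ('s, 'a, 'k) nsgrp_scheme \<Rightarrow>
    ('t, 'a, 'l) nsgrp_scheme \<Rightarrow> ('s \<Rightarrow> 't) \<Rightarrow> bool" where
  "nsgrp_morphism R S S' \<phi> \<longleftrightarrow>
     (\<forall>s\<in>carrier S. \<phi> s \<in> carrier S') \<and>
     (\<forall>s\<in>carrier S. \<forall>t\<in>carrier S. \<phi> (s \<oplus>\<^bsub>S\<^esub> t) = \<phi> s \<oplus>\<^bsub>S'\<^esub> \<phi> t) \<and>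
     (\<forall>s\<in>carrier S. \<forall>a\<in>carrier R. \<phi> (s \<odot>\<^bsub>S\<^esub> a) = \<phi> s \<odot>\<^bsub>S'\<^esub> a)"

definition nsgrp_kernel ::
    "('s, 'a, 'k) nsgrp_scheme \<Rightarrow> ('t, 'a, 'l) nsgrp_scheme \<Rightarrow> ('s \<Rightarrow> 't) \<Rightarrow> 's set" where
  "nsgrp_kernel S S' \<phi> = {s \<in> carrier S. \<phi> s = sident S'}"

text \<open>An existential over all target semigroups cannot range over types, so the type of the elements
  of the target is a parameter.\<close>

definition right_ideal :: "'t itself \<Rightarrow> ('a, 'm) nsring0_scheme \<Rightarrow> 'a set \<Rightarrow> bool" where
  "right_ideal _ R I \<longleftrightarrow>
     (\<exists>(S :: ('t, 'a) nsgrp) \<phi>. near_semiring_semigroup R S \<and>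
        nsgrp_morphism R (regular_nsgrp R) S \<phi> \<and>
        I = nsgrp_kernel (regular_nsgrp R) S \<phi>)"


section \<open>The structures are what their names say\<close>

lemma brandt_add_assoc: "brandt_add (brandt_add x y) z = brandt_add x (brandt_add y z)"
  by (cases x; cases y; cases z) simp_all

lemma semigroup_on_Brandt: "semigroup_on (carrier (Brandt n)) (splus (Brandt n))"
proof -
  have "brandt_add x y \<in> carrier (Brandt n)"
    if "x \<in> carrier (Brandt n)" "y \<in> carrier (Brandt n)" for x y
    using that by (cases x; cases y) (simp_all add: Brandt_def)
  moreover have "splus (Brandt n) = brandt_add"
    by (simp add: Brandt_def)
  ultimately show ?thesis
    by (simp only: semigroup_on_def brandt_add_assoc) blast
qed

lemma near_semiring_map_nsring:
  assumes "semigroup_on (carrier S) (splus S)"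
  shows "near_semiring (map_nsring S)"
proof -
  have cl: "x \<oplus>\<^bsub>S\<^esub> y \<in> carrier S" if "x \<in> carrier S" "y \<in> carrier S" for x y
    using assms that unfolding semigroup_on_def by blast
  have as: "x \<oplus>\<^bsub>S\<^esub> y \<oplus>\<^bsub>S\<^esub> z = x \<oplus>\<^bsub>S\<^esub> (y \<oplus>\<^bsub>S\<^esub> z)"
    if "x \<in> carrier S" "y \<in> carrier S" "z \<in> carrier S" for x y z
    using assms that unfolding semigroup_on_def by blast
  show ?thesis
    unfolding near_semiring_def semigroup_on_def map_nsring_def
    by (simp add: PiE_iff cl as cong: restrict_cong)
qed

lemma affine_maps_subset:
  assumes "semigroup_on (carrier S) (splus S)"
  shows "affine_maps S \<subseteq> carrier (map_nsring S)"
proof -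
  have "g \<oplus>\<^bsub>map_nsring S\<^esub> h \<in> carrier (map_nsring S)" if "g \<in> sgrp_End S" "h \<in> const_maps S" for g h
  proof -
    have "g \<in> carrier (map_nsring S)" "h \<in> carrier (map_nsring S)"
      using that by (auto simp: sgrp_End_def const_maps_def map_nsring_def)
    then show ?thesis
      using near_semiring_map_nsring[OF assms] unfolding near_semiring_def semigroup_on_def by blast
  qed
  then show ?thesis
    unfolding affine_maps_def by blast
qed

lemma near_semiring_affine_nsring:
  assumes "semigroup_on (carrier S) (splus S)"
  shows "near_semiring (affine_nsring S)"
proof -
  have R: "near_semiring (map_nsring S)"
    by (rule near_semiring_map_nsring[OF assms])
  have "a \<in> carrier (map_nsring S)" if "a \<in> subnsring_gen (map_nsring S) (affine_maps S)" for a
    using that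
  proof induction
    case (gen a)
    then show ?case using affine_maps_subset[OF assms] by blast
  next
    case (add a b)
    then show ?case using R by (simp add: near_semiring_def semigroup_on_def)
  next
    case (mult a b)
    then show ?case using R by (simp add: near_semiring_def semigroup_on_def)
  qed
  then show ?thesis
    using R unfolding near_semiring_def semigroup_on_def affine_nsring_def
    by (simp add: subnsring_gen.add subnsring_gen.mult)
qed

lemma zero_symmetric_adjoin_zero:
  assumes "near_semiring R"
  shows "zero_symmetric_near_semiring (adjoin_zero R)"
  using assms
  unfolding zero_symmetric_near_semiring_def near_semiring_def semigroup_on_def adjoin_zero_def
  by (auto split: option.splits)

lemma zero_symmetric_Brandt_affine: "zero_symmetric_near_semiring (Brandt_affine n)"
  unfolding Brandt_affine_def
  by (intro zero_symmetric_adjoin_zero near_semiring_affine_nsring semigroup_on_Brandt)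

lemma near_semiring_semigroup_regular:
  assumes "zero_symmetric_near_semiring R"
  shows "near_semiring_semigroup R (regular_nsgrp R)"
  using assms
  unfolding near_semiring_semigroup_def regular_nsgrp_def zero_symmetric_near_semiring_def
    near_semiring_def semigroup_on_def
  by simp

end

theory Submission
  imports Defs
begin

text \<open>The constant map \<open>\<theta>\<close> with value \<open>Theta\<close> is affine, and every nonzero \<open>a\<close> in the near-semiring
  satisfies \<open>a \<theta> = \<theta>\<close>, because \<open>\<theta>\<close> is constant, while every \<open>a\<close> satisfies \<open>a + \<theta> = \<theta>\<close>, because \<open>Theta\<close>
  absorbs.  These two equations decide everything.  Let \<open>I\<close> be the kernel of \<open>\<phi>\<close>.  If \<open>I\<close> contains a
  nonzero \<open>a\<close>, then it contains \<open>a \<theta> = \<theta>\<close>, since kernels are closed under right multiplication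
  (\<open>right_ideal_mult_closed\<close>).  Then \<open>b \<phi> = b \<phi> + \<theta> \<phi> = (b + \<theta>) \<phi> = \<theta> \<phi>\<close> is the identity for every \<open>b\<close>, so \<open>I\<close>
  is the whole near-semiring.  The argument works in every zero-symmetric near-semiring with such a \<open>\<theta>\<close>
  (\<open>right_ideal_trivial_if_absorbing\<close>).  Conversely, the zero ideal and the whole near-semiring are
  the kernels of the identity and of the zero morphism.\<close>

lemma right_ideal_zero:
  fixes R :: "('a, 'm) nsring0_scheme"
  assumes R: "zero_symmetric_near_semiring R"
  shows "right_ideal TYPE('a) R {\<zero>\<^bsub>R\<^esub>}"
proof -
  have "nsgrp_morphism R (regular_nsgrp R) (regular_nsgrp R) (\<lambda>s. s)"
    by (simp add: nsgrp_morphism_def)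
  moreover have "{\<zero>\<^bsub>R\<^esub>} = nsgrp_kernel (regular_nsgrp R) (regular_nsgrp R) (\<lambda>s. s)"
    using R by (auto simp: nsgrp_kernel_def regular_nsgrp_def zero_symmetric_near_semiring_def)
  ultimately show ?thesis
    unfolding right_ideal_def using near_semiring_semigroup_regular[OF R] by blast
qed

lemma right_ideal_carrier:
  fixes R :: "('a, 'm) nsring0_scheme"
  assumes R: "zero_symmetric_near_semiring R"
  shows "right_ideal TYPE('a) R (carrier R)"
proof -
  have "nsgrp_morphism R (regular_nsgrp R) (regular_nsgrp R) (\<lambda>s. \<zero>\<^bsub>R\<^esub>)"
    using R by (simp add: nsgrp_morphism_def regular_nsgrp_def zero_symmetric_near_semiring_def)
  moreover have "carrier R = nsgrp_kernel (regular_nsgrp R) (regular_nsgrp R) (\<lambda>s. \<zero>\<^bsub>R\<^esub>)"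
    by (simp add: nsgrp_kernel_def regular_nsgrp_def)
  ultimately show ?thesis
    unfolding right_ideal_def using near_semiring_semigroup_regular[OF R] by blast
qed

text \<open>A morphism is only required to preserve addition and the action.  It preserves the identity
  because \<open>0 \<phi> = (0 0) \<phi> = (0 \<phi>) 0\<close>, and any \<open>s 0\<close> is the identity.\<close>

lemma nsgrp_morphism_zero:
  assumes R: "zero_symmetric_near_semiring R" and S: "near_semiring_semigroup R S"
    and \<phi>: "nsgrp_morphism R (regular_nsgrp R) S \<phi>"
  shows "\<phi> \<zero>\<^bsub>R\<^esub> = sident S"
proof -
  have z: "\<zero>\<^bsub>R\<^esub> \<in> carrier R" and zz: "\<zero>\<^bsub>R\<^esub> \<otimes>\<^bsub>R\<^esub> \<zero>\<^bsub>R\<^esub> = \<zero>\<^bsub>R\<^esub>"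
    using R by (auto simp: zero_symmetric_near_semiring_def)
  have "\<phi> \<zero>\<^bsub>R\<^esub> = \<phi> (\<zero>\<^bsub>R\<^esub> \<otimes>\<^bsub>R\<^esub> \<zero>\<^bsub>R\<^esub>)"
    by (simp only: zz)
  also have "\<dots> = \<phi> \<zero>\<^bsub>R\<^esub> \<odot>\<^bsub>S\<^esub> \<zero>\<^bsub>R\<^esub>"
    using \<phi> z by (simp add: nsgrp_morphism_def regular_nsgrp_def)
  also have "\<dots> = sident S"
    using S \<phi> z by (simp add: near_semiring_semigroup_def nsgrp_morphism_def regular_nsgrp_def)
  finally show ?thesis .
qed

lemma right_ideal_zero_mem:
  assumes "zero_symmetric_near_semiring R" "right_ideal TYPE('t) R I"
  shows "\<zero>\<^bsub>R\<^esub> \<in> I"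
  using assms nsgrp_morphism_zero[OF assms(1)]
  by (auto simp: right_ideal_def nsgrp_kernel_def regular_nsgrp_def
      zero_symmetric_near_semiring_def)

text \<open>The elements \<open>a\<close> and \<open>0\<close> have the same image, hence so do \<open>a b\<close> and \<open>0 b = 0\<close>.\<close>

lemma right_ideal_mult_closed:
  assumes R: "zero_symmetric_near_semiring R" and I: "right_ideal TYPE('t) R I"
    and a: "a \<in> I" and b: "b \<in> carrier R"
  shows "a \<otimes>\<^bsub>R\<^esub> b \<in> I"
proof -
  obtain S :: "('t, 'a) nsgrp" and \<phi>
    where S: "near_semiring_semigroup R S"
      and \<phi>: "nsgrp_morphism R (regular_nsgrp R) S \<phi>"
      and ker: "I = nsgrp_kernel (regular_nsgrp R) S \<phi>"
    using I unfolding right_ideal_def by blast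
  have \<phi>_mult: "\<phi> (x \<otimes>\<^bsub>R\<^esub> b) = \<phi> x \<odot>\<^bsub>S\<^esub> b" if "x \<in> carrier R" for x
    using \<phi> b that by (simp add: nsgrp_morphism_def regular_nsgrp_def)
  have aR: "a \<in> carrier R" and \<phi>a: "\<phi> a = sident S"
    using a by (simp_all add: ker nsgrp_kernel_def regular_nsgrp_def)
  have z: "\<zero>\<^bsub>R\<^esub> \<in> carrier R" "\<zero>\<^bsub>R\<^esub> \<otimes>\<^bsub>R\<^esub> b = \<zero>\<^bsub>R\<^esub>"
    using R b by (auto simp: zero_symmetric_near_semiring_def)
  have \<phi>z: "\<phi> \<zero>\<^bsub>R\<^esub> = sident S"
    by (rule nsgrp_morphism_zero[OF R S \<phi>])
  have "\<phi> (a \<otimes>\<^bsub>R\<^esub> b) = \<phi> \<zero>\<^bsub>R\<^esub> \<odot>\<^bsub>S\<^esub> b"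
    by (simp only: \<phi>_mult[OF aR] \<phi>a \<phi>z)
  also have "\<dots> = sident S"
    using \<phi>_mult[OF z(1)] by (simp only: z \<phi>z)
  finally have "\<phi> (a \<otimes>\<^bsub>R\<^esub> b) = sident S" .
  moreover have "a \<otimes>\<^bsub>R\<^esub> b \<in> carrier R"
    using R aR b
    by (simp add: zero_symmetric_near_semiring_def near_semiring_def semigroup_on_def)
  ultimately show ?thesis
    by (simp add: ker nsgrp_kernel_def regular_nsgrp_def)
qed

text \<open>This is the cancellation property of kernels of semigroup homomorphisms: adding an element of
  the kernel does not change the image.\<close>

lemma right_ideal_add_cancel:
  assumes I: "right_ideal TYPE('t) R I"
    and b: "b \<in> carrier R" and c: "c \<in> I" and bc: "b \<oplus>\<^bsub>R\<^esub> c \<in> I"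
  shows "b \<in> I"
proof -
  obtain S :: "('t, 'a) nsgrp" and \<phi>
    where S: "near_semiring_semigroup R S"
      and \<phi>: "nsgrp_morphism R (regular_nsgrp R) S \<phi>"
      and ker: "I = nsgrp_kernel (regular_nsgrp R) S \<phi>"
    using I unfolding right_ideal_def by blast
  have cR: "c \<in> carrier R" and \<phi>c: "\<phi> c = sident S" and \<phi>bc: "\<phi> (b \<oplus>\<^bsub>R\<^esub> c) = sident S"
    using c bc by (simp_all add: ker nsgrp_kernel_def regular_nsgrp_def)
  have "\<phi> b \<in> carrier S"
    using \<phi> b by (simp add: nsgrp_morphism_def regular_nsgrp_def)
  then have "\<phi> b = \<phi> b \<oplus>\<^bsub>S\<^esub> \<phi> c"
    using S by (simp add: \<phi>c near_semiring_semigroup_def)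
  also have "\<dots> = \<phi> (b \<oplus>\<^bsub>R\<^esub> c)"
    using \<phi> b cR by (simp add: nsgrp_morphism_def regular_nsgrp_def)
  finally show ?thesis
    using b by (simp add: \<phi>bc ker nsgrp_kernel_def regular_nsgrp_def)
qed

lemma right_ideal_trivial_if_absorbing:
  assumes R: "zero_symmetric_near_semiring R" and I: "right_ideal TYPE('t) R I"
    and t: "t \<in> carrier R"
    and add_t: "\<And>a. a \<in> carrier R \<Longrightarrow> a \<oplus>\<^bsub>R\<^esub> t = t"
    and mult_t: "\<And>a. a \<in> carrier R \<Longrightarrow> a \<noteq> \<zero>\<^bsub>R\<^esub> \<Longrightarrow> a \<otimes>\<^bsub>R\<^esub> t = t"
  shows "I = carrier R \<or> I = {\<zero>\<^bsub>R\<^esub>}"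
proof (cases "I \<subseteq> {\<zero>\<^bsub>R\<^esub>}")
  case True
  then show ?thesis
    using right_ideal_zero_mem[OF R I] by blast
next
  case False
  have sub: "I \<subseteq> carrier R"
    using I by (auto simp: right_ideal_def nsgrp_kernel_def regular_nsgrp_def)
  from False obtain a where a: "a \<in> I" "a \<noteq> \<zero>\<^bsub>R\<^esub>"
    by blast
  then have "t \<in> I"
    using right_ideal_mult_closed[OF R I a(1) t] mult_t sub by auto
  then have "b \<in> I" if "b \<in> carrier R" for b
    using right_ideal_add_cancel[OF I that] add_t[OF that] by simp
  then show ?thesis
    using sub by blast
qed

lemma const_theta_mem_affine_nsring:
  "(\<lambda>x\<in>carrier (Brandt n). Theta) \<in> carrier (affine_nsring (Brandt n))"
proof -
  let ?B = "Brandt n" and ?t = "\<lambda>x\<in>carrier (Brandt n). Theta"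
  \<comment> \<open>Since \<open>Theta\<close> is idempotent, the constant map is also an endomorphism, and it is its own double.\<close>
  have T: "Theta \<in> carrier ?B" and idem: "Theta \<oplus>\<^bsub>?B\<^esub> Theta = Theta"
    by (simp_all add: Brandt_def)
  have "x \<oplus>\<^bsub>?B\<^esub> y \<in> carrier ?B" if "x \<in> carrier ?B" "y \<in> carrier ?B" for x y
    using semigroup_on_Brandt[of n] that by (simp add: semigroup_on_def)
  then have "?t \<in> sgrp_End ?B"
    using T by (simp add: sgrp_End_def idem)
  moreover have "?t \<in> const_maps ?B"
    using T by (auto simp: const_maps_def)
  ultimately have "?t \<oplus>\<^bsub>map_nsring ?B\<^esub> ?t \<in> affine_maps ?B"
    unfolding affine_maps_def by blast
  moreover have "?t \<oplus>\<^bsub>map_nsring ?B\<^esub> ?t = ?t"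
    by (simp add: map_nsring_def idem cong: restrict_cong)
  ultimately show ?thesis
    by (simp add: affine_nsring_def subnsring_gen.gen)
qed

lemma affine_nsring_maps:
  assumes "semigroup_on (carrier S) (splus S)" and "f \<in> carrier (affine_nsring S)"
  shows "f \<in> carrier S \<rightarrow>\<^sub>E carrier S"
proof -
  have M: "near_semiring (map_nsring S)"
    by (rule near_semiring_map_nsring[OF assms(1)])
  have "f \<in> subnsring_gen (map_nsring S) (affine_maps S)"
    using assms(2) by (simp add: affine_nsring_def)
  then have "f \<in> carrier (map_nsring S)"
  proof induction
    case (gen a)
    then show ?case using affine_maps_subset[OF assms(1)] by blast
  qed (use M in \<open>simp_all add: near_semiring_def semigroup_on_def\<close>)
  then show ?thesis
    by (simp add: map_nsring_def)
qed

lemma Brandt_affine_right_ideal_trivial: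
  assumes I: "right_ideal TYPE('t) (Brandt_affine n) I"
  shows "I = carrier (Brandt_affine n) \<or> I = {\<zero>\<^bsub>Brandt_affine n\<^esub>}"
proof -
  let ?B = "Brandt n" and ?t = "\<lambda>x\<in>carrier (Brandt n). Theta"
  have absorb: "x \<oplus>\<^bsub>?B\<^esub> Theta = Theta" for x
    by (cases x) (simp_all add: Brandt_def)
  have add_t: "f \<oplus>\<^bsub>affine_nsring ?B\<^esub> ?t = ?t" for f
    by (simp add: affine_nsring_def map_nsring_def absorb cong: restrict_cong)
  have mult_t: "f \<otimes>\<^bsub>affine_nsring ?B\<^esub> ?t = ?t" if "f \<in> carrier (affine_nsring ?B)" for f
  proof -
    have "f x \<in> carrier ?B" if "x \<in> carrier ?B" for x
      using affine_nsring_maps[OF semigroup_on_Brandt \<open>f \<in> _\<close>] that by blast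
    then show ?thesis
      by (simp add: affine_nsring_def map_nsring_def cong: restrict_cong)
  qed
  show ?thesis
  proof (rule right_ideal_trivial_if_absorbing[OF zero_symmetric_Brandt_affine I])
    show "Some ?t \<in> carrier (Brandt_affine n)"
      using const_theta_mem_affine_nsring
      by (simp add: Brandt_affine_def adjoin_zero_def)
  next
    fix a assume "a \<in> carrier (Brandt_affine n)"
    then show "a \<oplus>\<^bsub>Brandt_affine n\<^esub> Some ?t = Some ?t"
      by (cases a) (simp_all add: Brandt_affine_def adjoin_zero_def add_t)
  next
    fix a assume "a \<in> carrier (Brandt_affine n)" "a \<noteq> \<zero>\<^bsub>Brandt_affine n\<^esub>"
    then show "a \<otimes>\<^bsub>Brandt_affine n\<^esub> Some ?t = Some ?t"
      by (auto simp: Brandt_affine_def adjoin_zero_def mult_t)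
  qed
qed

theorem theorem3p2:
  fixes n :: nat
  assumes "n \<ge> 1"
  shows "{I. right_ideal TYPE((brandt \<Rightarrow> brandt) option) (Brandt_affine n) I}
           = {carrier (Brandt_affine n), {\<zero>\<^bsub>Brandt_affine n\<^esub>}} \<and>
         {I. right_ideal TYPE('t) (Brandt_affine n) I}
           \<subseteq> {carrier (Brandt_affine n), {\<zero>\<^bsub>Brandt_affine n\<^esub>}}"
proof (intro conjI equalityI subsetI)
  fix I assume "I \<in> {I. right_ideal TYPE((brandt \<Rightarrow> brandt) option) (Brandt_affine n) I}"
  then show "I \<in> {carrier (Brandt_affine n), {\<zero>\<^bsub>Brandt_affine n\<^esub>}}"
    by (simp add: Brandt_affine_right_ideal_trivial)
next
  fix I assume "I \<in> {carrier (Brandt_affine n), {\<zero>\<^bsub>Brandt_affine n\<^esub>}}"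
  then show "I \<in> {I. right_ideal TYPE((brandt \<Rightarrow> brandt) option) (Brandt_affine n) I}"
    using right_ideal_zero[OF zero_symmetric_Brandt_affine]
      right_ideal_carrier[OF zero_symmetric_Brandt_affine] by auto
next
  fix I assume "I \<in> {I. right_ideal TYPE('t) (Brandt_affine n) I}"
  then show "I \<in> {carrier (Brandt_affine n), {\<zero>\<^bsub>Brandt_affine n\<^esub>}}"
    by (simp add: Brandt_affine_right_ideal_trivial)
qed

end
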